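(* Let a DC cube be defined by 8 corner points $p_0=\infty$, $p_1,p_2,p_4\in\operatorname{Im}\mathbb H$, $p_3,p_5,p_6$ on the lines $\mathcal L(p_1,p_2)$, $\mathcal L(p_1,p_4)$, $\mathcal L(p_2,p_4)$ respectively, with the associated Miquel point $p_7$, and by an orthonormal frame $(v_1,v_2,v_3=v_1v_2)$ at $p_0$. Then the Miquel point $p_7$ can be expressed as $$\begin{aligned} p_7&=p_1+A(A-B)^{-1}(p_2-p_1)\\ &=p_2+B(B-C)^{-1}(p_4-p_2)\\ &=p_4+C(C-A)^{-1}(p_1-p_4), \end{aligned}$$ where (quaternion products) $$A=(p_4-p_1)(p_3-p_5)(p_1-p_2),\quad B=(p_1-p_2)(p_6-p_3)(p_2-p_4),\quad C=(p_2-p_4)(p_5-p_6)(p_4-p_1).$$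
   Context: $\mathbb H$ is the algebra of real quaternions. $\operatorname{Im}\mathbb H$ is the space of purely imaginary quaternions, identified with Euclidean $\mathbb R^3$, and $\widehat{\mathbb R}^3=\operatorname{Im}\mathbb H\cup\{\infty\}$. $\mathcal L(p,q)$ is the line through $p$ and $q$. DC (Dupin cyclidic) cube: a map $F:[0,1]^3\to\widehat{\mathbb R}^3$, $F=UW^{-1}$ (with value $\infty$ where $W=0$), where $U,W$ are polynomials in the real variables $s,t,u$ with quaternionic coefficients, of degree at most one in each variable, such that $\partial_sF,\partial_tF,\partial_uF$ are mutually orthogonal and the Jacobian of $F$ is not identically zero. Its corner points are $p_{i+2j+4k}=F(i,j,k)$, $i,j,k\in\{0,1\}$. When $p_0=\infty$, the frame $(v_1,v_2,v_3)$ at $p_0$ means that the edges joining $p_0$ to $p_1$, $p_2$, $p_4$ are the half-lines starting from $p_1,p_2,p_4$ in the directions $v_1,v_2,v_3$ respectively. Miquel point: the common point of the circle through $p_1,p_3,p_5$, the circle through $p_2,p_3,p_6$ and the circle through $p_4,p_5,p_6$, provided by Miquel's theorem. $A,B,C$ are the right quaternionic factors of the weight $w_7=(p_7-p_1)^{-1}A=(p_7-p_2)^{-1}B=(p_7-p_4)^{-1}C$ that is attached to the corner $p_7$ in the trilinear quaternionic Bézier parametrization of this cube. *)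

theory Defs
  imports "HOL-Analysis.Analysis"
begin

section \<open>Real quaternions\<close>

datatype quat = Quat (qRe: real) (qI: real) (qJ: real) (qK: real)

lemma quat_eq_iff: "x = y \<longleftrightarrow> qRe x = qRe y \<and> qI x = qI y \<and> qJ x = qJ y \<and> qK x = qK y"
  by (cases x; cases y) simp

instantiation quat :: real_vector
begin

definition "0 = Quat 0 0 0 0"
definition "x + y = Quat (qRe x + qRe y) (qI x + qI y) (qJ x + qJ y) (qK x + qK y)"
definition "x - y = Quat (qRe x - qRe y) (qI x - qI y) (qJ x - qJ y) (qK x - qK y)"
definition "- x = Quat (- qRe x) (- qI x) (- qJ x) (- qK x)"
definition "r *\<^sub>R x = Quat (r * qRe x) (r * qI x) (r * qJ x) (r * qK x)"

lemmas quat_vector_defs =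
  zero_quat_def plus_quat_def minus_quat_def uminus_quat_def scaleR_quat_def

instance
  by standard (simp_all add: quat_vector_defs quat_eq_iff algebra_simps)

end

instantiation quat :: real_div_algebra
begin

definition "1 = Quat 1 0 0 0"
definition "x * y = Quat
  (qRe x * qRe y - qI x * qI y - qJ x * qJ y - qK x * qK y)
  (qRe x * qI y + qI x * qRe y + qJ x * qK y - qK x * qJ y)
  (qRe x * qJ y - qI x * qK y + qJ x * qRe y + qK x * qI y)
  (qRe x * qK y + qI x * qJ y - qJ x * qI y + qK x * qRe y)"
definition "inverse x = (let n = (qRe x)\<^sup>2 + (qI x)\<^sup>2 + (qJ x)\<^sup>2 + (qK x)\<^sup>2
  in Quat (qRe x / n) (- qI x / n) (- qJ x / n) (- qK x / n))"
definition "(x::quat) div y = x * inverse y"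

lemma quat_sumsq_eq_0_iff:
  "(a::real)\<^sup>2 + b\<^sup>2 + c\<^sup>2 + d\<^sup>2 = 0 \<longleftrightarrow> a = 0 \<and> b = 0 \<and> c = 0 \<and> d = 0"
  by (smt (verit, best) power_zero_numeral zero_eq_power2 zero_le_power2)

instance
proof
  fix x :: quat
  define n where "n = (qRe x)\<^sup>2 + (qI x)\<^sup>2 + (qJ x)\<^sup>2 + (qK x)\<^sup>2"
  assume "x \<noteq> 0"
  then have n: "n \<noteq> 0"
    unfolding n_def quat_sumsq_eq_0_iff by (simp add: quat_eq_iff zero_quat_def)
  have inv: "inverse x = Quat (qRe x / n) (- qI x / n) (- qJ x / n) (- qK x / n)"
    by (simp add: inverse_quat_def n_def Let_def)
  show "inverse x * x = 1" "x * inverse x = 1"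
    using n by (auto simp: inv times_quat_def one_quat_def field_simps)
      (auto simp: n_def power2_eq_square algebra_simps)
qed (simp_all add: quat_vector_defs times_quat_def one_quat_def inverse_quat_def
      divide_quat_def quat_eq_iff algebra_simps)

end

instantiation quat :: real_inner
begin

definition "x \<bullet> y = qRe x * qRe y + qI x * qI y + qJ x * qJ y + qK x * qK y"
definition "norm (x::quat) = sqrt (x \<bullet> x)"
definition "sgn (x::quat) = x /\<^sub>R norm x"
definition "dist (x::quat) y = norm (x - y)"
definition [code del]:
  "(uniformity :: (quat \<times> quat) filter) = (INF e\<in>{0 <..}. principal {(x, y). dist x y < e})"
definition [code del]:
  "open (S :: quat set) \<longleftrightarrow> (\<forall>x\<in>S. \<forall>\<^sub>F (x', y) in uniformity. x' = x \<longrightarrow> y \<in> S)"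

instance
proof
  fix x y z :: quat and r :: real
  show "0 \<le> x \<bullet> x"
    by (simp add: inner_quat_def)
  show "x \<bullet> x = 0 \<longleftrightarrow> x = 0"
    using quat_sumsq_eq_0_iff[of "qRe x" "qI x" "qJ x" "qK x"]
    by (simp add: inner_quat_def power2_eq_square quat_eq_iff zero_quat_def)
qed (simp_all add: dist_quat_def sgn_quat_def uniformity_quat_def open_quat_def norm_quat_def
      quat_vector_defs inner_quat_def algebra_simps)

end

instance quat :: real_normed_div_algebra
proof
  fix x y :: quat
  show "norm (x * y) = norm x * norm y"
    unfolding norm_quat_def real_sqrt_mult[symmetric]
    by (simp add: inner_quat_def times_quat_def algebra_simps)
qed

definition ImH :: "quat set" where
  "ImH = {x. qRe x = 0}"

text \<open>The coordinates of an imaginary quaternion; only used on \<^term>\<open>ImH\<close>.\<close>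

definition vec3 :: "quat \<Rightarrow> real ^ 3" where
  "vec3 x = vector [qI x, qJ x, qK x]"

section \<open>The extended space and its circles\<close>

datatype ext_quat = Fin quat | Infty

definition hatR3 :: "ext_quat set" where
  "hatR3 = insert Infty (Fin ` ImH)"

text \<open>The line through two points is \<^term>\<open>affine hull {p, q}\<close>. A circle of the extended space
  is a Euclidean circle (a sphere cut by a plane through its centre) or a line with the point
  at infinity added.\<close>

definition is_circle :: "ext_quat set \<Rightarrow> bool" where
  "is_circle C \<longleftrightarrow>
     (\<exists>m\<in>ImH. \<exists>n\<in>ImH. \<exists>r>0. n \<noteq> 0 \<and> C = Fin ` {x \<in> ImH. (x - m) \<bullet> n = 0 \<and> dist x m = r})
   \<or> (\<exists>p\<in>ImH. \<exists>q\<in>ImH. p \<noteq> q \<and> C = insert Infty (Fin ` (affine hull {p, q})))"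

text \<open>Three points determine a circle only if they are distinct.\<close>

definition circle_through :: "ext_quat set \<Rightarrow> quat \<Rightarrow> quat \<Rightarrow> quat \<Rightarrow> bool" where
  "circle_through C a b c \<longleftrightarrow>
     distinct [a, b, c] \<and> is_circle C \<and> Fin a \<in> C \<and> Fin b \<in> C \<and> Fin c \<in> C"

text \<open>``The'' common point includes uniqueness: if \<open>p1\<close>, \<open>p2\<close>, \<open>p4\<close> are collinear, the three
  circles are the same line and there is no Miquel point.\<close>

definition miquel_point ::
  "quat \<Rightarrow> quat \<Rightarrow> quat \<Rightarrow> quat \<Rightarrow> quat \<Rightarrow> quat \<Rightarrow> quat \<Rightarrow> bool" where
  "miquel_point p1 p2 p4 p3 p5 p6 p7 \<longleftrightarrow>
     (\<exists>C1 C2 C4. circle_through C1 p1 p3 p5 \<and> circle_through C2 p2 p3 p6 \<and>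
        circle_through C4 p4 p5 p6 \<and> C1 \<inter> C2 \<inter> C4 = {Fin p7})"

section \<open>Dupin cyclidic cubes\<close>

definition trilinear_poly :: "(real \<Rightarrow> real \<Rightarrow> real \<Rightarrow> quat) \<Rightarrow> bool" where
  "trilinear_poly P \<longleftrightarrow> (\<exists>a :: nat \<Rightarrow> nat \<Rightarrow> nat \<Rightarrow> quat. \<forall>s t u.
     P s t u = (\<Sum>i\<le>1. \<Sum>j\<le>1. \<Sum>k\<le>1. (s ^ i * t ^ j * u ^ k) *\<^sub>R a i j k))"

definition partial1 :: "(real \<Rightarrow> real \<Rightarrow> real \<Rightarrow> quat) \<Rightarrow> real \<Rightarrow> real \<Rightarrow> real \<Rightarrow> quat" where
  "partial1 Q s t u = vector_derivative (\<lambda>x. Q x t u) (at s)"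

definition partial2 :: "(real \<Rightarrow> real \<Rightarrow> real \<Rightarrow> quat) \<Rightarrow> real \<Rightarrow> real \<Rightarrow> real \<Rightarrow> quat" where
  "partial2 Q s t u = vector_derivative (\<lambda>x. Q s x u) (at t)"

definition partial3 :: "(real \<Rightarrow> real \<Rightarrow> real \<Rightarrow> quat) \<Rightarrow> real \<Rightarrow> real \<Rightarrow> real \<Rightarrow> quat" where
  "partial3 Q s t u = vector_derivative (\<lambda>x. Q s t x) (at u)"

definition jacobian :: "(real \<Rightarrow> real \<Rightarrow> real \<Rightarrow> quat) \<Rightarrow> real \<Rightarrow> real \<Rightarrow> real \<Rightarrow> real" where
  "jacobian Q s t u =
     det (vector [vec3 (partial1 Q s t u), vec3 (partial2 Q s t u), vec3 (partial3 Q s t u)]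
       :: real ^ 3 ^ 3)"

text \<open>Only the values of \<open>F\<close> on the unit cube matter. Where \<open>W\<close> does not vanish, the rational
  expression \<open>U W\<^sup>-\<^sup>1\<close> is smooth in a neighbourhood, so two-sided derivatives of it are meaningful
  also at boundary points of the cube.\<close>

definition dc_cube :: "(real \<Rightarrow> real \<Rightarrow> real \<Rightarrow> ext_quat) \<Rightarrow> bool" where
  "dc_cube F \<longleftrightarrow> (\<exists>U W. trilinear_poly U \<and> trilinear_poly W \<and>
     (let Q = (\<lambda>s t u. U s t u * inverse (W s t u)) in
        (\<forall>s\<in>{0..1}. \<forall>t\<in>{0..1}. \<forall>u\<in>{0..1}.
           F s t u = (if W s t u = 0 then Infty else Fin (Q s t u)) \<and>
           F s t u \<in> hatR3 \<and>
           (W s t u \<noteq> 0 \<longrightarrow>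
              partial1 Q s t u \<bullet> partial2 Q s t u = 0 \<and>
              partial1 Q s t u \<bullet> partial3 Q s t u = 0 \<and>
              partial2 Q s t u \<bullet> partial3 Q s t u = 0)) \<and>
        (\<exists>s\<in>{0..1}. \<exists>t\<in>{0..1}. \<exists>u\<in>{0..1}. W s t u \<noteq> 0 \<and> jacobian Q s t u \<noteq> 0)))"

definition half_line :: "quat \<Rightarrow> quat \<Rightarrow> ext_quat set" where
  "half_line p v = insert Infty (Fin ` {p + r *\<^sub>R v | r. 0 \<le> r})"

text \<open>The frame \<open>(v1, v2, v3)\<close> at the corner \<open>F 0 0 0 = Infty\<close>: the three edges issuing from it
  are half-lines starting from \<open>p1\<close>, \<open>p2\<close>, \<open>p4\<close>.\<close>

definition frame_at_infinity ::
  "(real \<Rightarrow> real \<Rightarrow> real \<Rightarrow> ext_quat) \<Rightarrow> quat \<Rightarrow> quat \<Rightarrow> quat \<Rightarrow> quat \<Rightarrow> quat \<Rightarrow> quat \<Rightarrow> bool" where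
  "frame_at_infinity F p1 p2 p4 v1 v2 v3 \<longleftrightarrow>
     (\<lambda>s. F s 0 0) ` {0..1} = half_line p1 v1 \<and>
     (\<lambda>t. F 0 t 0) ` {0..1} = half_line p2 v2 \<and>
     (\<lambda>u. F 0 0 u) ` {0..1} = half_line p4 v3"

end

theory Submission
  imports Defs
begin

text \<open>If \<open>p\<^sub>1, p\<^sub>2, p\<^sub>4\<close> were collinear, the three Miquel circles would be lines sharing the point
  at infinity. Otherwise put \<open>b = p\<^sub>2 - p\<^sub>1\<close> and \<open>c = p\<^sub>4 - p\<^sub>1\<close>. A product of three imaginary
  quaternions in the plane spanned by \<open>b\<close> and \<open>c\<close> is again a vector of this plane. So \<open>A\<close> and
  \<open>A - B\<close> are real combinations of \<open>b\<close> and \<open>c\<close>; in \<open>A - B\<close> the coefficient of \<open>c\<close> is \<open>b \<bullet> b\<close>, hence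
  \<open>A - B \<noteq> 0\<close>. Then \<open>p\<^sub>1 + A (A - B)\<^sup>-\<^sup>1 b\<close> has explicit coordinates in the plane, and they satisfy
  the equations of all three circles, whose only common point is \<open>p\<^sub>7\<close>. The other two formulas
  follow by cyclic symmetry.\<close>

section \<open>Products of three imaginary quaternions\<close>

lemma subspace_ImH: "subspace ImH"
  by (auto simp: subspace_def ImH_def quat_vector_defs)

text \<open>For imaginary factors, \<open>x * y\<close> has real part
  \<open>- (x \<bullet> y)\<close> and the cross product as imaginary part. Multiplying by
  \<open>z\<close> and expanding the double cross product gives the vector part; the real part is
  minus the determinant of the three vectors.\<close>

lemma triple_product_imaginary:
  assumes "x \<in> ImH" "y \<in> ImH" "z \<in> ImH"
  shows "x * y * z = (x \<bullet> z) *\<^sub>R y - (x \<bullet> y) *\<^sub>R z - (y \<bullet> z) *\<^sub>R x + qRe (x * y * z) *\<^sub>R 1"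
  using assms
  by (simp add: quat_vector_defs times_quat_def inner_quat_def one_quat_def quat_eq_iff ImH_def
      algebra_simps)

text \<open>The real part is, up to sign, the volume spanned by the three factors, so it vanishes
  for coplanar vectors.\<close>

lemma triple_product_planar:
  assumes b: "b \<in> ImH" and c: "c \<in> ImH"
    and span: "x \<in> span {b, c}" "y \<in> span {b, c}" "z \<in> span {b, c}"
  shows "x * y * z = (x \<bullet> z) *\<^sub>R y - (x \<bullet> y) *\<^sub>R z - (y \<bullet> z) *\<^sub>R x"
proof -
  have "span {b, c} \<subseteq> ImH"
    using b c by (intro span_minimal subspace_ImH) auto
  then have im: "x \<in> ImH" "y \<in> ImH" "z \<in> ImH"
    using span by auto
  obtain x1 x2 y1 y2 z1 z2 where xyz: "x = x1 *\<^sub>R b + x2 *\<^sub>R c" "y = y1 *\<^sub>R b + y2 *\<^sub>R c"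
    "z = z1 *\<^sub>R b + z2 *\<^sub>R c"
    using span unfolding span_insert span_empty by (auto simp: algebra_simps)
  have lin: "qRe (u + v) = qRe u + qRe v" "qRe (r *\<^sub>R u) = r * qRe u" for u v r
    by (simp_all add: quat_vector_defs)
  \<comment> \<open>Among three factors taken from two vectors one repeats, so the determinant is
    zero; multilinearity then covers the whole span.\<close>
  have zero: "qRe (u * v * w) = 0" if "u \<in> {b, c}" "v \<in> {b, c}" "w \<in> {b, c}" for u v w
    using that b c by (auto simp: times_quat_def ImH_def algebra_simps)
  have "qRe (x * y * z) = 0"
    by (simp add: xyz distrib_left distrib_right lin zero)
  then show ?thesis
    by (subst triple_product_imaginary[OF im]) simp
qed

section \<open>Collinearity and circles of the extended space\<close>

lemma collinear_3_diff: "collinear {a, b, c} \<longleftrightarrow> collinear {0, b - a, c - a}"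
  by (subst insert_commute) (simp add: collinear_3)

lemma collinear_0_diffD:
  assumes "collinear {0, e, f - e}"
  shows "collinear {0, e, f}"
proof -
  from assms consider "e = 0" | "f = e" | u where "f - e = u *\<^sub>R e"
    by (auto simp: collinear_lemma)
  then show ?thesis
  proof cases
    case (3 u)
    then have "f = (u + 1) *\<^sub>R e"
      by (simp add: algebra_simps)
    then show ?thesis
      unfolding collinear_lemma by blast
  qed auto
qed

text \<open>A Euclidean line meets a sphere in at most two points, so a circle containing three
  distinct collinear points has to be an extended line.\<close>

lemma Infty_in_circle_through_collinear:
  assumes C: "circle_through C a b c" and col: "collinear {a, b, c}"
  shows "Infty \<in> C"
proof (rule ccontr)
  assume "Infty \<notin> C"
  then obtain m r where "dist a m = r" "dist b m = r" "dist c m = r"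
    using C unfolding circle_through_def is_circle_def by auto
  then have eq: "(a - m) \<bullet> (a - m) = (b - m) \<bullet> (b - m)" "(a - m) \<bullet> (a - m) = (c - m) \<bullet> (c - m)"
    by (metis dist_norm norm_eq)+
  have ne: "a \<noteq> b" "a \<noteq> c" "b \<noteq> c"
    using C by (auto simp: circle_through_def)
  have "collinear {0, b - a, c - a}"
    using col unfolding collinear_3_diff[of a b c] .
  with ne obtain t where t: "c - a = t *\<^sub>R (b - a)"
    by (auto simp: collinear_lemma)
  define e where "e = b - a"
  have b: "b = a + e" and c: "c = a + t *\<^sub>R e"
    using t by (auto simp: e_def algebra_simps)
  have "t \<noteq> 0" "t \<noteq> 1" "e \<bullet> e \<noteq> 0"
    using ne b c by auto
  \<comment> \<open>The points \<open>a + s *\<^sub>R e\<close> at the same distance from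
    \<open>m\<close> as \<open>a\<close> satisfy
    \<open>s * (2 * ((a - m) \<bullet> e) + s * (e \<bullet> e)) = 0\<close>. This has only one root
    besides zero at most, but both 1 and \<open>t\<close> are such roots.\<close>
  moreover have "2 * ((a - m) \<bullet> e) + e \<bullet> e = 0"
    using eq(1) by (simp add: b inner_commute algebra_simps)
  moreover have "t * (2 * ((a - m) \<bullet> e) + t * (e \<bullet> e)) = 0"
    using eq(2) by (simp add: c inner_commute algebra_simps)
  ultimately have "t * (e \<bullet> e) = e \<bullet> e"
    unfolding mult_eq_0_iff by linarith
  then show False
    using \<open>t \<noteq> 1\<close> \<open>e \<bullet> e \<noteq> 0\<close> by simp
qed

text \<open>Subtracting \<open>|a - m|\<^sup>2 = r\<^sup>2\<close> makes the equation of a sphere with centre \<open>m\<close> through \<open>a\<close>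
  affine in the scalar product with \<open>a - m\<close>, so that the other two given points fix it on the plane.\<close>

lemma in_circle_throughI:
  assumes C: "circle_through C a (a + \<alpha> *\<^sub>R e) (a + \<beta> *\<^sub>R f)"
    and nc: "\<not> collinear {0, e, f}"
    and x: "x \<in> ImH" "x = a + s *\<^sub>R e + t *\<^sub>R f"
    and eq: "(x - a) \<bullet> (x - a) = s * \<alpha> * (e \<bullet> e) + t * \<beta> * (f \<bullet> f)"
  shows "Fin x \<in> C"
proof -
  have ne: "\<alpha> \<noteq> 0" "\<beta> \<noteq> 0"
    using C by (auto simp: circle_through_def)
  have "\<not> collinear {0, \<alpha> *\<^sub>R e, \<beta> *\<^sub>R f}"
  proof
    assume "collinear {0, \<alpha> *\<^sub>R e, \<beta> *\<^sub>R f}"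
    moreover have "e \<noteq> 0" "f \<noteq> 0"
      using nc by (auto simp: insert_commute)
    ultimately obtain u where "\<beta> *\<^sub>R f = (u * \<alpha>) *\<^sub>R e"
      using ne by (auto simp: collinear_lemma)
    then have "f = (u * \<alpha> / \<beta>) *\<^sub>R e"
      using ne unfolding eq_vector_fraction_iff by simp
    then show False
      using nc unfolding collinear_lemma by blast
  qed
  then have "\<not> collinear {a, a + \<alpha> *\<^sub>R e, a + \<beta> *\<^sub>R f}"
    by (simp add: collinear_3_diff[of a])
  then have "\<not> {a, a + \<alpha> *\<^sub>R e, a + \<beta> *\<^sub>R f} \<subseteq> affine hull {p, q}" for p q
    by (meson collinear_2 collinear_affine_hull_collinear collinear_subset)
  \<comment> \<open>Noncollinear points exclude the line alternative of
    \<open>is_circle\<close>.\<close>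
  then obtain m n r where Ceq: "C = Fin ` {x \<in> ImH. (x - m) \<bullet> n = 0 \<and> dist x m = r}"
    using C unfolding circle_through_def is_circle_def by auto
  have mem: "(y - m) \<bullet> n = 0" "(y - m) \<bullet> (y - m) = r\<^sup>2"
    if "y \<in> {a, a + \<alpha> *\<^sub>R e, a + \<beta> *\<^sub>R f}" for y
    using C that unfolding circle_through_def Ceq
    by (auto simp: dist_norm power2_norm_eq_inner[symmetric])
  define w where "w = a - m"
  have "w \<bullet> n = 0" "e \<bullet> n = 0" "f \<bullet> n = 0"
    using mem(1)[of a] mem(1)[of "a + \<alpha> *\<^sub>R e"] mem(1)[of "a + \<beta> *\<^sub>R f"] ne
    by (auto simp: w_def inner_simps)
  then have plane: "(x - m) \<bullet> n = 0"
    by (simp add: x w_def inner_simps)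
  have "\<alpha> * (2 * (w \<bullet> e) + \<alpha> * (e \<bullet> e)) = 0" "\<beta> * (2 * (w \<bullet> f) + \<beta> * (f \<bullet> f)) = 0"
    using mem(2)[of a] mem(2)[of "a + \<alpha> *\<^sub>R e"] mem(2)[of "a + \<beta> *\<^sub>R f"]
    by (auto simp: w_def inner_commute algebra_simps)
  then have "\<alpha> * (e \<bullet> e) = - 2 * (w \<bullet> e)" "\<beta> * (f \<bullet> f) = - 2 * (w \<bullet> f)"
    using ne by auto
  \<comment> \<open>Weighting the two sphere equations by \<open>s\<close> and \<open>t\<close>
    turns \<open>eq\<close> into the condition that \<open>x\<close> is as far from \<open>m\<close>
    as \<open>a\<close> is.\<close>
  then have "(x - a) \<bullet> (x - a) = - 2 * (w \<bullet> (x - a))"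
    unfolding eq mult.assoc by (simp add: x(2) inner_simps algebra_simps)
  moreover have "(w + d) \<bullet> (w + d) = w \<bullet> w + 2 * (w \<bullet> d) + d \<bullet> d" for d
    by (simp add: inner_commute algebra_simps)
  ultimately have "(w + (x - a)) \<bullet> (w + (x - a)) = w \<bullet> w"
    by simp
  then have "(x - m) \<bullet> (x - m) = w \<bullet> w"
    by (simp add: w_def)
  then have "dist x m = norm w"
    by (simp add: dist_norm norm_eq)
  also have "\<dots> = dist a m"
    by (simp add: w_def dist_norm)
  also have "\<dots> = r"
    using C unfolding circle_through_def Ceq by auto
  finally show ?thesis
    using x(1) plane by (auto simp: Ceq)
qed

section \<open>The Miquel configuration\<close>

lemma miquel_point_not_collinear:
  assumes miquel: "miquel_point p1 p2 p4 p3 p5 p6 p7"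
    and lines: "p3 \<in> affine hull {p1, p2}" "p5 \<in> affine hull {p1, p4}" "p6 \<in> affine hull {p2, p4}"
  shows "\<not> collinear {p1, p2, p4}"
proof
  assume "collinear {p1, p2, p4}"
  then have col: "collinear S" if "S \<subseteq> affine hull {p1, p2, p4}" for S
    using that collinear_affine_hull_collinear collinear_subset by blast
  have vertices: "{p1, p2, p4} \<subseteq> affine hull {p1, p2, p4}"
    by (rule hull_subset)
  have "p3 \<in> affine hull {p1, p2, p4}" "p5 \<in> affine hull {p1, p2, p4}"
    "p6 \<in> affine hull {p1, p2, p4}"
    using lines by (auto elim!: set_mp[OF hull_mono, rotated])
  with vertices have "collinear {p1, p3, p5}" "collinear {p2, p3, p6}" "collinear {p4, p5, p6}"
    by (auto intro!: col)
  then show False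
    using miquel Infty_in_circle_through_collinear unfolding miquel_point_def by blast
qed

text \<open>The renaming \<open>p1\<close>, \<open>p2\<close>, \<open>p4\<close> to
  \<open>p2\<close>, \<open>p4\<close>, \<open>p1\<close> sends \<open>p3\<close>,
  \<open>p6\<close>, \<open>p5\<close> to \<open>p6\<close>, \<open>p5\<close>, \<open>p3\<close>,
  and hence the products \<open>A\<close>, \<open>B\<close>, \<open>C\<close> of the theorem to
  \<open>B\<close>, \<open>C\<close>, \<open>A\<close>.\<close>

lemma miquel_point_rotate:
  assumes "miquel_point p1 p2 p4 p3 p5 p6 p7"
  shows "miquel_point p2 p4 p1 p6 p3 p5 p7"
proof -
  from assms obtain C1 C2 C4 where "circle_through C1 p1 p3 p5" "circle_through C2 p2 p3 p6"
    "circle_through C4 p4 p5 p6" "C1 \<inter> C2 \<inter> C4 = {Fin p7}"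
    unfolding miquel_point_def by blast
  then have "circle_through C2 p2 p6 p3" "circle_through C4 p4 p6 p5" "circle_through C1 p1 p3 p5"
    "C2 \<inter> C4 \<inter> C1 = {Fin p7}"
    by (auto simp: circle_through_def)
  then show ?thesis
    unfolding miquel_point_def by blast
qed

lemma miquel_point_formula:
  assumes imaginary: "p1 \<in> ImH" "p2 \<in> ImH" "p4 \<in> ImH"
    and on_lines: "p3 \<in> affine hull {p1, p2}" "p5 \<in> affine hull {p1, p4}"
      "p6 \<in> affine hull {p2, p4}"
    and miquel: "miquel_point p1 p2 p4 p3 p5 p6 p7"
    and A: "A = (p4 - p1) * (p3 - p5) * (p1 - p2)"
    and B: "B = (p1 - p2) * (p6 - p3) * (p2 - p4)"
  shows "A - B \<noteq> 0 \<and> p7 = p1 + A * inverse (A - B) * (p2 - p1)"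
proof -
  define b c where "b = p2 - p1" and "c = p4 - p1"
  have p2: "p2 = p1 + b" and p4: "p4 = p1 + c"
    by (simp_all add: b_def c_def)
  have im: "b \<in> ImH" "c \<in> ImH"
    using imaginary by (simp_all add: b_def c_def subspace_diff[OF subspace_ImH])
  have nc: "\<not> collinear {0, b, c}"
    using miquel_point_not_collinear[OF miquel on_lines]
    unfolding b_def c_def collinear_3_diff[of p1 p2 p4] .
  obtain \<alpha> \<beta> \<gamma> where p3: "p3 = p1 + \<alpha> *\<^sub>R b" and p5: "p5 = p1 + \<beta> *\<^sub>R c"
    and p6: "p6 = p1 + b + \<gamma> *\<^sub>R (c - b)"
  proof -
    from on_lines obtain \<alpha> \<beta> \<gamma> where "p3 = p1 + \<alpha> *\<^sub>R (p2 - p1)" "p5 = p1 + \<beta> *\<^sub>R (p4 - p1)"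
      "p6 = p2 + \<gamma> *\<^sub>R (p4 - p2)"
      unfolding affine_hull_2_alt by blast
    then show ?thesis
      by (intro that[of \<alpha> \<beta> \<gamma>]) (simp_all add: p2 p4)
  qed
  \<comment> \<open>With the Gram matrix entries of \<open>b\<close> and \<open>c\<close>, the
    remaining claims become polynomial identities in these three numbers and \<alpha>, \<beta>,
    \<gamma>.\<close>
  define P Q R where "P = b \<bullet> b" and "Q = c \<bullet> c" and "R = b \<bullet> c"
  have R': "c \<bullet> b = R"
    by (simp add: R_def inner_commute)
  note ips = P_def[symmetric] Q_def[symmetric] R_def[symmetric] R'
  \<comment> \<open>\<open>D\<close> will turn out to be \<open>A - B\<close>, with \<open>k\<close>
    as its coefficient of \<open>b\<close>; its squared norm is \<open>P * N\<close>.\<close>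
  define k where "k = \<gamma> * (P + Q - 2 * R) - \<beta> * Q - (1 - \<alpha>) * P"
  define N where "N = P * Q + 2 * k * R + k\<^sup>2"
  define D where "D = P *\<^sub>R c + k *\<^sub>R b"
  have span: "b \<in> span {b, c}" "c \<in> span {b, c}"
    by (simp_all add: span_base)
  note triple = triple_product_planar[OF im]
  have Aeq: "A = (\<alpha> * P) *\<^sub>R c - (\<beta> * Q) *\<^sub>R b"
  proof -
    have "A = c * (\<alpha> *\<^sub>R b - \<beta> *\<^sub>R c) * (- b)"
      by (simp add: A p2 p3 p4 p5)
    also have "\<dots> = (\<alpha> * P) *\<^sub>R c - (\<beta> * Q) *\<^sub>R b"
      by (subst triple) (simp_all add: span span_diff span_scale span_neg inner_simps ips algebra_simps)
    finally show ?thesis .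
  qed
  have Beq: "B = A - D"
  proof -
    have "B = (- b) * ((1 - \<alpha>) *\<^sub>R b + \<gamma> *\<^sub>R (c - b)) * (b - c)"
      by (simp add: B p2 p3 p4 p6 algebra_simps)
    also have "\<dots> = A - D"
      unfolding Aeq D_def k_def
      by (subst triple) (simp_all add: span span_add span_diff span_scale span_neg inner_simps ips algebra_simps)
    finally show ?thesis .
  qed
  have "P \<noteq> 0"
    using nc by (auto simp: P_def)
  have "D \<noteq> 0"
  proof
    assume "D = 0"
    then have "P *\<^sub>R c = - k *\<^sub>R b"
      by (simp add: D_def add_eq_0_iff2)
    then have "c = (- k / P) *\<^sub>R b"
      using \<open>P \<noteq> 0\<close> unfolding eq_vector_fraction_iff by simp
    then show False
      using nc unfolding collinear_lemma by blast
  qed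
  have DD: "D \<bullet> D = P * N"
    by (simp add: D_def N_def inner_simps ips power2_eq_square algebra_simps)
  have "N \<noteq> 0"
    using DD \<open>D \<noteq> 0\<close> by auto
  \<comment> \<open>These are the coordinates of \<open>A * inverse D * b\<close> in the basis
    \<open>b\<close>, \<open>c\<close>, read off from the planar triple product
    \<open>A * D * b\<close>.\<close>
  define x y where "x = (\<alpha> * P * Q - 2 * \<beta> * Q * R - k * \<beta> * Q) / N"
    and "y = (\<beta> * P * Q + k * \<alpha> * P) / N"
  have xN: "x * N = \<alpha> * P * Q - 2 * \<beta> * Q * R - k * \<beta> * Q" and yN: "y * N = \<beta> * P * Q + k * \<alpha> * P"
    using \<open>N \<noteq> 0\<close> by (simp_all add: x_def y_def)
  define M where "M = p1 + x *\<^sub>R b + y *\<^sub>R c"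
  \<comment> \<open>An imaginary quaternion squares to minus its squared norm.\<close>
  have D_inv: "inverse D = (- 1 / (P * N)) *\<^sub>R D"
  proof (rule inverse_unique)
    have "qRe D = 0"
      using im by (simp add: D_def ImH_def quat_vector_defs)
    then have "D * D = - (D \<bullet> D) *\<^sub>R 1"
      by (simp add: times_quat_def inner_quat_def quat_vector_defs one_quat_def)
    then show "D * ((- 1 / (P * N)) *\<^sub>R D) = 1"
      using \<open>P \<noteq> 0\<close> \<open>N \<noteq> 0\<close> by (simp add: DD)
  qed
  have "A * D * b = (- (P * (x * N))) *\<^sub>R b - (P * (y * N)) *\<^sub>R c"
    unfolding xN yN Aeq D_def
    by (subst triple) (simp_all add: span span_add span_diff span_scale inner_simps ips
      algebra_simps, simp add: scaleR_left_distrib[symmetric])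
  then have "A * D * b = (- (P * N)) *\<^sub>R (x *\<^sub>R b + y *\<^sub>R c)"
    by (simp add: scaleR_add_right mult_ac)
  then have "A * inverse D * b = x *\<^sub>R b + y *\<^sub>R c"
    using \<open>P \<noteq> 0\<close> \<open>N \<noteq> 0\<close> by (simp add: D_inv)
  then have M: "M = p1 + A * inverse (A - B) * (p2 - p1)"
    by (simp add: M_def Beq b_def[symmetric] add.assoc)
  have "M \<in> ImH"
    using imaginary(1) im subspace_ImH by (simp add: M_def subspace_add subspace_scale)
  obtain C1 C2 C4 where C1: "circle_through C1 p1 p3 p5" and C2: "circle_through C2 p2 p3 p6"
    and C4: "circle_through C4 p4 p5 p6" and C: "C1 \<inter> C2 \<inter> C4 = {Fin p7}"
    using miquel unfolding miquel_point_def by blast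
  \<comment> \<open>This is the equation of \<open>C1\<close> at \<open>M\<close>, proved after
    clearing the denominator \<open>N\<^sup>2\<close>.\<close>
  have sq: "x\<^sup>2 * P + 2 * x * y * R + y\<^sup>2 * Q = x * \<alpha> * P + y * \<beta> * Q"
  proof -
    have "(x * N)\<^sup>2 * P + 2 * (x * N) * (y * N) * R + (y * N)\<^sup>2 * Q
        = N * ((x * N) * \<alpha> * P + (y * N) * \<beta> * Q)"
      unfolding xN yN unfolding N_def by (simp add: power2_eq_square algebra_simps)
    then have "N\<^sup>2 * (x\<^sup>2 * P + 2 * x * y * R + y\<^sup>2 * Q) = N\<^sup>2 * (x * \<alpha> * P + y * \<beta> * Q)"
      by (simp add: power2_eq_square algebra_simps)
    then show ?thesis
      using \<open>N \<noteq> 0\<close> by simp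
  qed
  \<comment> \<open>Subtracting the equation of \<open>C1\<close> from those of \<open>C2\<close>
    and \<open>C4\<close> leaves these two linear equations, the radical axes. Their determinant is
    \<open>N\<close>, and \<open>x\<close>, \<open>y\<close> solve them by Cramer's rule.\<close>
  have lin: "\<alpha> * P = x * P + y * (2 * R + k)" "y * Q = \<beta> * Q + x * k"
  proof -
    have "N * (\<alpha> * P) = (x * N) * P + (y * N) * (2 * R + k)" "(y * N) * Q = N * (\<beta> * Q) + (x * N) * k"
      unfolding xN yN unfolding N_def by (simp_all add: power2_eq_square algebra_simps)
    then have "N * (\<alpha> * P) = N * (x * P + y * (2 * R + k))" "N * (y * Q) = N * (\<beta> * Q + x * k)"
      by (simp_all add: algebra_simps)
    then show "\<alpha> * P = x * P + y * (2 * R + k)" "y * Q = \<beta> * Q + x * k"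
      using \<open>N \<noteq> 0\<close> by simp_all
  qed
  have "Fin M \<in> C1"
  proof (rule in_circle_throughI[OF C1[unfolded p3 p5] nc \<open>M \<in> ImH\<close> M_def])
    have "M - p1 = x *\<^sub>R b + y *\<^sub>R c"
      by (simp add: M_def)
    then have "(M - p1) \<bullet> (M - p1) = x\<^sup>2 * P + 2 * x * y * R + y\<^sup>2 * Q"
      by (simp add: inner_simps ips power2_eq_square algebra_simps)
    then show "(M - p1) \<bullet> (M - p1) = x * \<alpha> * (b \<bullet> b) + y * \<beta> * (c \<bullet> c)"
      by (simp add: sq ips)
  qed
  moreover have "Fin M \<in> C2"
  \<comment> \<open>The base point moves to the vertex \<open>p2\<close>, where the sides have
    directions \<open>b\<close> and \<open>c - b\<close>. The quadratic part of the equation is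
    replaced through \<open>sq\<close>, and \<open>lin(1)\<close> settles what is left; at
    \<open>p4\<close> the same works with \<open>lin(2)\<close>.\<close>
  proof (rule in_circle_throughI[where a = p2])
    have "p3 = p2 + (\<alpha> - 1) *\<^sub>R b" "p6 = p2 + \<gamma> *\<^sub>R (c - b)"
      by (simp_all add: p2 p3 p6 algebra_simps)
    then show "circle_through C2 p2 (p2 + (\<alpha> - 1) *\<^sub>R b) (p2 + \<gamma> *\<^sub>R (c - b))"
      using C2 by simp
    show "\<not> collinear {0, b, c - b}"
      using nc collinear_0_diffD[of b c] by (auto simp: insert_commute)
    show "M = p2 + (x + y - 1) *\<^sub>R b + y *\<^sub>R (c - b)"
      by (simp add: M_def p2 algebra_simps)
    have diff: "M - p2 = (x - 1) *\<^sub>R b + y *\<^sub>R c"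
      by (simp add: M_def p2 algebra_simps)
    have "(M - p2) \<bullet> (M - p2) = (x\<^sup>2 * P + 2 * x * y * R + y\<^sup>2 * Q) - 2 * x * P + P - 2 * y * R"
      unfolding diff by (simp add: inner_simps ips power2_eq_square algebra_simps)
    also have "\<dots> = (x + y - 1) * (\<alpha> - 1) * P + y * \<gamma> * (P + Q - 2 * R)"
      unfolding sq using lin(1) unfolding k_def by (simp add: algebra_simps)
    also have "\<dots> = (x + y - 1) * (\<alpha> - 1) * (b \<bullet> b) + y * \<gamma> * ((c - b) \<bullet> (c - b))"
      by (simp add: inner_simps ips)
    finally show "(M - p2) \<bullet> (M - p2) = \<dots>" .
  qed (fact \<open>M \<in> ImH\<close>)
  moreover have "Fin M \<in> C4"
  proof (rule in_circle_throughI[where a = p4])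
    have "p5 = p4 + (\<beta> - 1) *\<^sub>R c" "p6 = p4 + (1 - \<gamma>) *\<^sub>R (b - c)"
      by (simp_all add: p4 p5 p6 algebra_simps)
    then show "circle_through C4 p4 (p4 + (\<beta> - 1) *\<^sub>R c) (p4 + (1 - \<gamma>) *\<^sub>R (b - c))"
      using C4 by simp
    show "\<not> collinear {0, c, b - c}"
      using nc collinear_0_diffD[of c b] by (auto simp: insert_commute)
    show "M = p4 + (x + y - 1) *\<^sub>R c + x *\<^sub>R (b - c)"
      by (simp add: M_def p4 algebra_simps)
    have diff: "M - p4 = x *\<^sub>R b + (y - 1) *\<^sub>R c"
      by (simp add: M_def p4 algebra_simps)
    have "(M - p4) \<bullet> (M - p4) = (x\<^sup>2 * P + 2 * x * y * R + y\<^sup>2 * Q) - 2 * y * Q + Q - 2 * x * R"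
      unfolding diff by (simp add: inner_simps ips power2_eq_square algebra_simps)
    also have "\<dots> = (x + y - 1) * (\<beta> - 1) * Q + x * (1 - \<gamma>) * (P + Q - 2 * R)"
      unfolding sq using lin(2) unfolding k_def by (simp add: algebra_simps)
    also have "\<dots> = (x + y - 1) * (\<beta> - 1) * (c \<bullet> c) + x * (1 - \<gamma>) * ((b - c) \<bullet> (b - c))"
      by (simp add: inner_simps ips)
    finally show "(M - p4) \<bullet> (M - p4) = \<dots>" .
  qed (fact \<open>M \<in> ImH\<close>)
  ultimately have "M = p7"
    using C by blast
  moreover have "A - B = D"
    by (simp add: Beq)
  ultimately show ?thesis
    using M \<open>D \<noteq> 0\<close> by metis
qed

theorem corollary4p2:
  fixes F :: "real \<Rightarrow> real \<Rightarrow> real \<Rightarrow> ext_quat"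
    and p1 p2 p3 p4 p5 p6 p7 v1 v2 v3 A B C :: quat
  assumes cube: "dc_cube F"
    and corners: "F 0 0 0 = Infty" "F 1 0 0 = Fin p1" "F 0 1 0 = Fin p2" "F 1 1 0 = Fin p3"
      "F 0 0 1 = Fin p4" "F 1 0 1 = Fin p5" "F 0 1 1 = Fin p6" "F 1 1 1 = Fin p7"
    and imaginary: "p1 \<in> ImH" "p2 \<in> ImH" "p4 \<in> ImH"
    and on_lines: "p3 \<in> affine hull {p1, p2}" "p5 \<in> affine hull {p1, p4}"
      "p6 \<in> affine hull {p2, p4}"
    and miquel: "miquel_point p1 p2 p4 p3 p5 p6 p7"
    and orthonormal: "v1 \<in> ImH" "v2 \<in> ImH" "norm v1 = 1" "norm v2 = 1" "v1 \<bullet> v2 = 0"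
      "v3 = v1 * v2"
    and frame: "frame_at_infinity F p1 p2 p4 v1 v2 v3"
    and A: "A = (p4 - p1) * (p3 - p5) * (p1 - p2)"
    and B: "B = (p1 - p2) * (p6 - p3) * (p2 - p4)"
    and C: "C = (p2 - p4) * (p5 - p6) * (p4 - p1)"
  shows "A - B \<noteq> 0 \<and> B - C \<noteq> 0 \<and> C - A \<noteq> 0 \<and>
    p7 = p1 + A * inverse (A - B) * (p2 - p1) \<and>
    p7 = p2 + B * inverse (B - C) * (p4 - p2) \<and>
    p7 = p4 + C * inverse (C - A) * (p1 - p4)"
proof -
  have lines': "p3 \<in> affine hull {p2, p1}" "p5 \<in> affine hull {p4, p1}" "p6 \<in> affine hull {p4, p2}"
    using on_lines by (simp_all add: insert_commute)
  note miquel' = miquel_point_rotate[OF miquel]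
  show ?thesis
    using miquel_point_formula[OF imaginary on_lines miquel A B]
      miquel_point_formula[OF imaginary(2,3,1) on_lines(3) lines'(1,2) miquel' B C]
      miquel_point_formula[OF imaginary(3,1,2) lines'(2,3) on_lines(1) miquel_point_rotate[OF miquel'] C A]
    by (elim conjE, intro conjI)
qed

end
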